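(* Let $\pi^{(1)},\dots,\pi^{(K)}$ be target policies in a finite-horizon MDP with horizon $T$. For every $t\in\{0,\dots,T-1\}$ and $s\in\mathcal S$, the distribution $$\hat\mu_t(a|s)\propto\sqrt{\sum_{k=1}^K \pi^{(k)}_t(a|s)^2\,\hat q_{\pi^{(k)},t}(s,a)}$$ is an optimal solution of $$\min_{\mu_t\in\hat\Lambda}\ \sum_{k=1}^K \mathbb V\left(G^{\mathrm{PDIS}}_k\left(\tau^{\{\mu_t,\pi^{(k)}_{t+1},\dots,\pi^{(k)}_{T-1}\}}_{t:T-1}\right)\,\middle|\,S_t=s\right),$$ where $\mu_t\in\hat\Lambda$ means that for all $k$ and all states $s'$ and actions $a$, $\mu_t(a|s')=0$ implies $\pi^{(k)}_t(a|s')\,\hat q_{\pi^{(k)},t}(s',a)=0$.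
   Context: Setting. A finite-horizon MDP has a finite state space $\mathcal S$, finite action space $\mathcal A$, deterministic reward function $r:\mathcal S\times\mathcal A\to\mathbb R$, transition probabilities $p(s'|s,a)$, and horizon $T\ge 1$. A (time-dependent) policy is a family $\mu=(\mu_t)_{t=0}^{T-1}$ where $\mu_t(\cdot|s)$ is a probability distribution on $\mathcal A$ for every $s$. Under $\mu$, at time $t$, $A_t\sim\mu_t(\cdot|S_t)$, $R_{t+1}=r(S_t,A_t)$, $S_{t+1}\sim p(\cdot|S_t,A_t)$. There are $K\ge1$ target policies $\pi^{(1)},\dots,\pi^{(K)}$. Conditioning on $S_t=s$ means starting the process at time $t$ in state $s$. Value functions (undiscounted): $v_{\pi,t}(s)=\mathbb E_\pi[\sum_{i=t+1}^T R_i\mid S_t=s]$ and $q_{\pi,t}(s,a)=\mathbb E_\pi[\sum_{i=t+1}^T R_i\mid S_t=s,A_t=a]$. $\tau^{\mu_{t:T-1}}_{t:T-1}=\{S_t,A_t,R_{t+1},\dots,S_{T-1},A_{T-1},R_T\}$ denotes a random trajectory segment generated by $\mu$ from time $t$ to $T-1$; $\tau^{\{\mu_t,\pi^{(k)}_{t+1},\dots,\pi^{(k)}_{T-1}\}}_{t:T-1}$ is such a segment generated by using $\mu_t$ at time $t$ and $\pi^{(k)}$ at all later times. The per-decision importance sampling (PDIS) estimator for $\pi^{(k)}$ from data generated by a behavior policy $\mu$ is $$G^{\mathrm{PDIS}}_k\left(\tau^{\mu_{t:T-1}}_{t:T-1}\right)=\sum_{i=t}^{T-1}\left(\prod_{j=t}^{i}\rho^{\pi^{(k)},\mu}_j\right)R_{i+1},\qquad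 \rho^{\pi^{(k)},\mu}_j=\frac{\pi^{(k)}_j(A_j|S_j)}{\mu_j(A_j|S_j)},$$ where $\mu$ is the policy that actually generated the segment (so the ratio is $1$ at every time when $\pi^{(k)}$ itself is used). $\mathbb V$ denotes variance. Define $\nu_{\pi^{(k)},t}(s,a)=\mathbb V\left(v_{\pi^{(k)},t+1}(S_{t+1})\mid S_t=s,A_t=a\right)$ for $t\le T-2$. Define $\hat q_{\pi^{(k)},T-1}(s,a)=q_{\pi^{(k)},T-1}(s,a)^2$, and for $t\le T-2$, $$\hat q_{\pi^{(k)},t}(s,a)=q_{\pi^{(k)},t}(s,a)^2+\nu_{\pi^{(k)},t}(s,a)+\sum_{s'}p(s'|s,a)\,\mathbb V\left(G^{\mathrm{PDIS}}_k\left(\tau^{\pi^{(k)}_{t+1:T-1}}_{t+1:T-1}\right)\,\middle|\,S_{t+1}=s'\right),$$ which is non-negative. The notation $\mu(a)\propto f(a)$ with $f\ge0$ means $\mu(a)=f(a)/\sum_b f(b)$, and means the uniform distribution $1/|\mathcal A|$ if $f\equiv0$. *)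

theory Defs
  imports "HOL-Probability.Probability"
begin

record ('s, 'a) mdp =
  transition :: "'s \<Rightarrow> 'a \<Rightarrow> 's pmf"
  reward :: "'s \<Rightarrow> 'a \<Rightarrow> real"
  horizon :: nat

text \<open>A policy maps a time and a state to a distribution on actions. Only the times below the
  horizon are ever used.\<close>

type_synonym ('s, 'a) policy = "nat \<Rightarrow> 's \<Rightarrow> 'a pmf"

text \<open>A segment started at time \<open>t\<close> is the list of triples \<open>(S\<^sub>i, A\<^sub>i, R\<^sub>i\<^sub>+\<^sub>1)\<close>
  for \<open>i = t, t + 1, \<dots>\<close>; the entry of time \<open>i\<close> sits at position \<open>i - t\<close>.\<close>

type_synonym ('s, 'a) segment = "('s \<times> 'a \<times> real) list"

definition state_at :: "nat \<Rightarrow> ('s, 'a) segment \<Rightarrow> nat \<Rightarrow> 's" where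
  "state_at t \<tau> i = fst (\<tau> ! (i - t))"

definition action_at :: "nat \<Rightarrow> ('s, 'a) segment \<Rightarrow> nat \<Rightarrow> 'a" where
  "action_at t \<tau> i = fst (snd (\<tau> ! (i - t)))"

text \<open>The reward received at time \<open>i\<close>, that is, the reward after the action of time \<open>i - 1\<close>.\<close>

definition reward_at :: "nat \<Rightarrow> ('s, 'a) segment \<Rightarrow> nat \<Rightarrow> real" where
  "reward_at t \<tau> i = snd (snd (\<tau> ! (i - 1 - t)))"

text \<open>The law of \<open>n\<close> steps of the process generated by \<open>\<mu>\<close>, started at time \<open>t\<close>
  in a given state.\<close>

primrec steps :: "('s, 'a) mdp \<Rightarrow> ('s, 'a) policy \<Rightarrow> nat \<Rightarrow> nat \<Rightarrow> 's \<Rightarrow> ('s, 'a) segment pmf" where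
  "steps M \<mu> 0 t s = return_pmf []"
| "steps M \<mu> (Suc n) t s =
     bind_pmf (\<mu> t s) (\<lambda>a. bind_pmf (transition M s a) (\<lambda>s'.
       map_pmf (\<lambda>\<tau>. (s, a, reward M s a) # \<tau>) (steps M \<mu> n (Suc t) s')))"

text \<open>The law of the segment from time \<open>t\<close> to the end, conditioned on \<open>S\<^sub>t = s\<close>.\<close>

definition traj :: "('s, 'a) mdp \<Rightarrow> ('s, 'a) policy \<Rightarrow> nat \<Rightarrow> 's \<Rightarrow> ('s, 'a) segment pmf" where
  "traj M \<mu> t s = steps M \<mu> (horizon M - t) t s"

text \<open>The same, conditioned on \<open>S\<^sub>t = s\<close> and \<open>A\<^sub>t = a\<close>, for \<open>t\<close> below the horizon.\<close>

definition traj_sa :: "('s, 'a) mdp \<Rightarrow> ('s, 'a) policy \<Rightarrow> nat \<Rightarrow> 's \<Rightarrow> 'a \<Rightarrow> ('s, 'a) segment pmf" where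
  "traj_sa M \<mu> t s a =
     bind_pmf (transition M s a) (\<lambda>s'.
       map_pmf (\<lambda>\<tau>. (s, a, reward M s a) # \<tau>) (traj M \<mu> (Suc t) s'))"

lemma traj_eq_bind_traj_sa:
  assumes "t < horizon M"
  shows "traj M \<mu> t s = bind_pmf (\<mu> t s) (traj_sa M \<mu> t s)"
proof -
  have "horizon M - t = Suc (horizon M - Suc t)"
    using assms by simp
  then show ?thesis
    by (simp add: traj_def traj_sa_def [abs_def])
qed

definition total_reward :: "('s, 'a) mdp \<Rightarrow> nat \<Rightarrow> ('s, 'a) segment \<Rightarrow> real" where
  "total_reward M t \<tau> = (\<Sum>i = t + 1..horizon M. reward_at t \<tau> i)"

definition state_value :: "('s, 'a) mdp \<Rightarrow> ('s, 'a) policy \<Rightarrow> nat \<Rightarrow> 's \<Rightarrow> real" where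
  "state_value M \<pi> t s = measure_pmf.expectation (traj M \<pi> t s) (total_reward M t)"

definition action_value :: "('s, 'a) mdp \<Rightarrow> ('s, 'a) policy \<Rightarrow> nat \<Rightarrow> 's \<Rightarrow> 'a \<Rightarrow> real" where
  "action_value M \<pi> t s a = measure_pmf.expectation (traj_sa M \<pi> t s a) (total_reward M t)"

definition importance_ratio :: "('s, 'a) policy \<Rightarrow> ('s, 'a) policy \<Rightarrow> nat \<Rightarrow> 's \<Rightarrow> 'a \<Rightarrow> real" where
  "importance_ratio \<pi> \<mu> j s a = pmf (\<pi> j s) a / pmf (\<mu> j s) a"

text \<open>The per-decision importance sampling estimator for the target policy \<open>\<pi>\<close>, evaluated on a
  segment generated by the behaviour policy \<open>\<mu>\<close> from time \<open>t\<close> on.\<close>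

definition pdis :: "('s, 'a) mdp \<Rightarrow> ('s, 'a) policy \<Rightarrow> ('s, 'a) policy \<Rightarrow> nat \<Rightarrow> ('s, 'a) segment \<Rightarrow> real" where
  "pdis M \<pi> \<mu> t \<tau> =
     (\<Sum>i = t..<horizon M.
        (\<Prod>j = t..i. importance_ratio \<pi> \<mu> j (state_at t \<tau> j) (action_at t \<tau> j)) * reward_at t \<tau> (i + 1))"

definition pdis_variance :: "('s, 'a) mdp \<Rightarrow> ('s, 'a) policy \<Rightarrow> ('s, 'a) policy \<Rightarrow> nat \<Rightarrow> 's \<Rightarrow> real" where
  "pdis_variance M \<pi> \<mu> t s = measure_pmf.variance (traj M \<mu> t s) (pdis M \<pi> \<mu> t)"

definition next_value_variance :: "('s, 'a) mdp \<Rightarrow> ('s, 'a) policy \<Rightarrow> nat \<Rightarrow> 's \<Rightarrow> 'a \<Rightarrow> real" where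
  "next_value_variance M \<pi> t s a =
     measure_pmf.variance (transition M s a) (state_value M \<pi> (t + 1))"

definition q_hat :: "('s::finite, 'a) mdp \<Rightarrow> ('s, 'a) policy \<Rightarrow> nat \<Rightarrow> 's \<Rightarrow> 'a \<Rightarrow> real" where
  "q_hat M \<pi> t s a =
     (if t = horizon M - 1 then (action_value M \<pi> t s a)\<^sup>2
      else (action_value M \<pi> t s a)\<^sup>2 + next_value_variance M \<pi> t s a
        + (\<Sum>s'\<in>UNIV. pmf (transition M s a) s' * pdis_variance M \<pi> \<pi> (t + 1) s'))"

text \<open>The distribution proportional to a non-negative function, uniform if the function vanishes
  identically.\<close>

definition proportional_pmf :: "('a::finite \<Rightarrow> real) \<Rightarrow> 'a pmf" where
  "proportional_pmf f =
     embed_pmf (\<lambda>a. if \<forall>b. f b = 0 then 1 / real CARD('a) else f a / (\<Sum>b\<in>UNIV. f b))"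

lemma pmf_proportional_pmf:
  fixes f :: "'a::finite \<Rightarrow> real"
  assumes nonneg: "\<And>a. 0 \<le> f a"
  shows "pmf (proportional_pmf f) a =
    (if \<forall>b. f b = 0 then 1 / real CARD('a) else f a / (\<Sum>b\<in>UNIV. f b))"
proof -
  define g where "g a = (if \<forall>b. f b = 0 then 1 / real CARD('a) else f a / (\<Sum>b\<in>UNIV. f b))" for a
  have g_nonneg: "0 \<le> g a" for a
    using nonneg by (simp add: g_def sum_nonneg)
  have g_sum: "(\<Sum>a\<in>UNIV. g a) = 1"
  proof (cases "\<forall>b. f b = 0")
    case True
    then show ?thesis by (simp add: g_def)
  next
    case False
    then have "(\<Sum>b\<in>UNIV. f b) \<noteq> 0"
      using nonneg by (subst sum_nonneg_eq_0_iff) auto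
    moreover have "g = (\<lambda>a. f a / (\<Sum>b\<in>UNIV. f b))"
      by (rule ext) (simp only: g_def False if_False)
    ultimately show ?thesis
      by (simp flip: sum_divide_distrib)
  qed
  have "(\<integral>\<^sup>+a. ennreal (g a) \<partial>count_space UNIV) = 1"
    using g_nonneg g_sum by (simp add: nn_integral_count_space_finite sum_ennreal)
  then have "pmf (embed_pmf g) a = g a"
    using g_nonneg by (intro pmf_embed_pmf)
  then show ?thesis
    by (simp only: proportional_pmf_def g_def [abs_def])
qed

text \<open>The target policies are \<open>\<pi> k\<close> for \<open>k = 1, \<dots>, K\<close>.\<close>

definition mu_hat ::
  "('s::finite, 'a::finite) mdp \<Rightarrow> nat \<Rightarrow> (nat \<Rightarrow> ('s, 'a) policy) \<Rightarrow> nat \<Rightarrow> 's \<Rightarrow> 'a pmf" where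
  "mu_hat M K \<pi> t s =
     proportional_pmf (\<lambda>a. sqrt (\<Sum>k = 1..K. (pmf (\<pi> k t s) a)\<^sup>2 * q_hat M (\<pi> k) t s a))"

definition Lambda_hat ::
  "('s::finite, 'a::finite) mdp \<Rightarrow> nat \<Rightarrow> (nat \<Rightarrow> ('s, 'a) policy) \<Rightarrow> nat \<Rightarrow> ('s \<Rightarrow> 'a pmf) set" where
  "Lambda_hat M K \<pi> t =
     {m. \<forall>k\<in>{1..K}. \<forall>s a. pmf (m s) a = 0 \<longrightarrow> pmf (\<pi> k t s) a * q_hat M (\<pi> k) t s a = 0}"

end

theory Submission imports Defs begin

text \<open>Given the first action \<open>a\<close>, the mixed segment continues on-policy, where the estimator is the
  plain return. By the law of total variance the second moment of that return is \<open>q_hat\<close>. Hence on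
  \<open>Lambda_hat\<close> the means of the estimators are constant, and the objective is
  \<open>\<Sum>a. w a\<^sup>2 / m a\<close> minus a constant, where \<open>w a\<^sup>2 = \<Sum>k. \<pi>\<^sub>k a\<^sup>2 * q_hat\<^sub>k a\<close>. By Cauchy-Schwarz it is
  at least \<open>(\<Sum>a. w a)\<^sup>2\<close> minus that constant, with equality for \<open>m\<close> proportional to \<open>w\<close>.\<close>

section \<open>Support and locality of the trajectory laws\<close>

lemma finite_set_steps:
  fixes M :: "('s::finite, 'a::finite) mdp"
  shows "finite (set_pmf (steps M \<mu> n t s))"
  by (induction n arbitrary: t s) auto

lemma finite_set_traj:
  fixes M :: "('s::finite, 'a::finite) mdp"
  shows "finite (set_pmf (traj M \<mu> t s))"
  by (simp add: traj_def finite_set_steps)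

lemma finite_set_traj_sa:
  fixes M :: "('s::finite, 'a::finite) mdp"
  shows "finite (set_pmf (traj_sa M \<mu> t s a))"
  by (auto simp: traj_sa_def finite_set_traj)

lemma steps_cong:
  assumes "\<And>j. t \<le> j \<Longrightarrow> \<mu> j = \<mu>' j"
  shows "steps M \<mu> n t s = steps M \<mu>' n t s"
  using assms
proof (induction n arbitrary: t s)
  case (Suc n)
  have "steps M \<mu> n (Suc t) s' = steps M \<mu>' n (Suc t) s'" for s'
    by (rule Suc.IH) (simp add: Suc.prems)
  then show ?case
    using Suc.prems[of t] by simp
qed simp

text \<open>Once the first action is fixed, only the policy at times after \<open>t\<close> is
  consulted.\<close>

lemma traj_sa_upd: "traj_sa M (\<mu>(t := m)) t s a = traj_sa M \<mu> t s a"
  unfolding traj_sa_def traj_def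
  by (subst steps_cong[of _ "\<mu>(t := m)" \<mu>]) auto

section \<open>The estimator and the return along a segment\<close>

lemma pdis_Cons:
  assumes "t < horizon M"
  shows "pdis M \<pi> \<mu> t ((s, a, x) # \<tau>) = importance_ratio \<pi> \<mu> t s a * (x + pdis M \<pi> \<mu> (Suc t) \<tau>)"
proof -
  let ?R = "\<lambda>t \<tau> j. importance_ratio \<pi> \<mu> j (state_at t \<tau> j) (action_at t \<tau> j)"
  let ?\<sigma> = "(s, a, x) # \<tau>"
  \<comment> \<open>Positions are relative to the starting time, so dropping the head moves them by
    one. The bound on \<open>j\<close> keeps natural subtraction from truncating.\<close>
  have shift: "?\<sigma> ! (j - t) = \<tau> ! (j - Suc t)" if "Suc t \<le> j" for j
  proof -
    have "j - t = Suc (j - Suc t)"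
      using that by simp
    then show ?thesis
      by simp
  qed
  have "pdis M \<pi> \<mu> t ?\<sigma> =
      ?R t ?\<sigma> t * x + (\<Sum>i = Suc t..<horizon M. (\<Prod>j = t..i. ?R t ?\<sigma> j) * reward_at t ?\<sigma> (i + 1))"
    using assms by (simp add: pdis_def sum.atLeast_Suc_lessThan reward_at_def)
  \<comment> \<open>Every product starts at \<open>t\<close>, so the ratio of time \<open>t\<close>
    factors out and what remains depends on the tail alone.\<close>
  also have "(\<Sum>i = Suc t..<horizon M. (\<Prod>j = t..i. ?R t ?\<sigma> j) * reward_at t ?\<sigma> (i + 1)) =
      (\<Sum>i = Suc t..<horizon M. ?R t ?\<sigma> t * ((\<Prod>j = Suc t..i. ?R (Suc t) \<tau> j) * reward_at (Suc t) \<tau> (i + 1)))"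
  proof (rule sum.cong)
    fix i assume i: "i \<in> {Suc t..<horizon M}"
    have "(\<Prod>j = t..i. ?R t ?\<sigma> j) = ?R t ?\<sigma> t * (\<Prod>j = Suc t..i. ?R t ?\<sigma> j)"
      using i by (simp add: prod.atLeast_Suc_atMost)
    also have "(\<Prod>j = Suc t..i. ?R t ?\<sigma> j) = (\<Prod>j = Suc t..i. ?R (Suc t) \<tau> j)"
      by (intro prod.cong) (auto simp: state_at_def action_at_def shift)
    finally show "(\<Prod>j = t..i. ?R t ?\<sigma> j) * reward_at t ?\<sigma> (i + 1) =
        ?R t ?\<sigma> t * ((\<Prod>j = Suc t..i. ?R (Suc t) \<tau> j) * reward_at (Suc t) \<tau> (i + 1))"
      using i shift[of i] by (simp add: reward_at_def)
  qed simp
  finally show ?thesis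
    by (simp add: pdis_def sum_distrib_left distrib_left state_at_def action_at_def)
qed

lemma pdis_upd: "t < t' \<Longrightarrow> pdis M \<pi> (\<mu>(t := m)) t' \<tau> = pdis M \<pi> \<mu> t' \<tau>"
  unfolding pdis_def importance_ratio_def
  by (intro sum.cong arg_cong2[where f = "(*)"] prod.cong) auto

lemma total_reward_Cons:
  assumes "t < horizon M"
  shows "total_reward M t ((s, a, x) # \<tau>) = x + total_reward M (Suc t) \<tau>"
proof -
  \<comment> \<open>The reward received at time \<open>i\<close> sits at position
    \<open>i - 1 - t\<close>, so it lies in the tail only from \<open>i = t + 2\<close> on.\<close>
  have "((s, a, x) # \<tau>) ! (i - 1 - t) = \<tau> ! (i - 1 - Suc t)" if "Suc (Suc t) \<le> i" for i
  proof -
    have "i - 1 - t = Suc (i - 1 - Suc t)"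
      using that by simp
    then show ?thesis
      by simp
  qed
  then show ?thesis
    using assms unfolding total_reward_def reward_at_def
    by (simp add: sum.atLeast_Suc_atMost)
qed

text \<open>The restriction to the support matters: on an action of probability 0 the ratio would be
  \<open>0 / 0\<close>, which is 0 and not 1.\<close>

lemma pdis_on_policy:
  assumes "\<tau> \<in> set_pmf (traj M \<pi> t s)"
  shows "pdis M \<pi> \<pi> t \<tau> = total_reward M t \<tau>"
  using assms
\<comment> \<open>The number of remaining steps decreases as the starting time moves
  forward.\<close>
proof (induction "horizon M - t" arbitrary: t s \<tau>)
  case 0
  then show ?case
    by (simp add: pdis_def total_reward_def)
next
  case (Suc n)
  then have t: "t < horizon M" and n: "n = horizon M - Suc t"
    by auto
  obtain a s' \<tau>' where a: "a \<in> set_pmf (\<pi> t s)" and \<tau>': "\<tau>' \<in> set_pmf (traj M \<pi> (Suc t) s')"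
    and \<tau>: "\<tau> = (s, a, reward M s a) # \<tau>'"
    using Suc.prems by (auto simp: traj_eq_bind_traj_sa[OF t] traj_sa_def)
  from a have "importance_ratio \<pi> \<pi> t s a = 1"
    by (simp add: importance_ratio_def set_pmf_iff)
  then show ?case
    using Suc.hyps(1)[OF n \<tau>'] by (simp add: \<tau> pdis_Cons[OF t] total_reward_Cons[OF t])
qed

text \<open>Only the first ratio differs from 1. The action \<open>a\<close> is fixed from outside,
  so \<open>m\<close> may give it probability 0; both sides are then 0.\<close>

lemma pdis_upd_traj_sa:
  assumes t: "t < horizon M" and \<tau>: "\<tau> \<in> set_pmf (traj_sa M \<pi> t s a)"
  shows "pdis M \<pi> (\<pi>(t := m)) t \<tau> = pmf (\<pi> t s) a / pmf (m s) a * total_reward M t \<tau>"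
proof -
  obtain s' \<tau>' where \<tau>': "\<tau>' \<in> set_pmf (traj M \<pi> (Suc t) s')" and eq: "\<tau> = (s, a, reward M s a) # \<tau>'"
    using \<tau> by (auto simp: traj_sa_def)
  show ?thesis
    using pdis_on_policy[OF \<tau>']
    by (simp add: eq pdis_Cons[OF t] total_reward_Cons[OF t] pdis_upd importance_ratio_def)
qed

section \<open>Moments of the return and the meaning of \<open>q_hat\<close>\<close>

lemma expectation_cong_pmf:
  assumes "\<And>x. x \<in> set_pmf p \<Longrightarrow> f x = (g x :: real)"
  shows "measure_pmf.expectation p f = measure_pmf.expectation p g"
  using assms by (intro integral_cong_AE) (auto simp: AE_measure_pmf_iff)

lemma pmf_variance_eq:
  fixes X :: "'b \<Rightarrow> real"
  assumes "finite (set_pmf p)"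
  shows "measure_pmf.variance p X =
    measure_pmf.expectation p (\<lambda>x. (X x)\<^sup>2) - (measure_pmf.expectation p X)\<^sup>2"
  using assms by (intro measure_pmf.variance_eq integrable_measure_pmf_finite)

lemma pdis_variance_on_policy:
  fixes M :: "('s::finite, 'a::finite) mdp"
  shows "pdis_variance M \<pi> \<pi> t s =
    measure_pmf.expectation (traj M \<pi> t s) (\<lambda>\<tau>. (total_reward M t \<tau>)\<^sup>2) - (state_value M \<pi> t s)\<^sup>2"
proof -
  have "measure_pmf.expectation (traj M \<pi> t s) (\<lambda>\<tau>. (pdis M \<pi> \<pi> t \<tau>)\<^sup>2) =
      measure_pmf.expectation (traj M \<pi> t s) (\<lambda>\<tau>. (total_reward M t \<tau>)\<^sup>2)"
    "measure_pmf.expectation (traj M \<pi> t s) (pdis M \<pi> \<pi> t) = state_value M \<pi> t s"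
    unfolding state_value_def by (intro expectation_cong_pmf; simp add: pdis_on_policy)+
  then show ?thesis
    unfolding pdis_variance_def pmf_variance_eq[OF finite_set_traj] by simp
qed

lemma expectation_traj_sa:
  fixes M :: "('s::finite, 'a::finite) mdp" and f :: "('s, 'a) segment \<Rightarrow> real"
  shows "measure_pmf.expectation (traj_sa M \<pi> t s a) f =
    (\<Sum>s'\<in>UNIV. pmf (transition M s a) s' *
       measure_pmf.expectation (traj M \<pi> (Suc t) s') (\<lambda>\<tau>. f ((s, a, reward M s a) # \<tau>)))"
  unfolding traj_sa_def
  by (subst pmf_expectation_bind[of UNIV]) (auto simp: finite_set_traj)

lemma state_value_horizon:
  assumes "horizon M \<le> t"
  shows "state_value M \<pi> t s = 0"
  using assms by (simp add: state_value_def total_reward_def [abs_def])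

lemma pdis_variance_horizon:
  assumes "horizon M \<le> t"
  shows "pdis_variance M \<pi> \<mu> t s = 0"
proof -
  have "pdis M \<pi> \<mu> t = (\<lambda>_. 0)"
    using assms by (simp add: pdis_def fun_eq_iff)
  then show ?thesis
    by (simp add: pdis_variance_def)
qed

text \<open>The case distinction at the last step disappears, as there is no variance left after it.\<close>

lemma q_hat_eq:
  assumes "t < horizon M"
  shows "q_hat M \<pi> t s a = (action_value M \<pi> t s a)\<^sup>2 + next_value_variance M \<pi> t s a
        + (\<Sum>s'\<in>UNIV. pmf (transition M s a) s' * pdis_variance M \<pi> \<pi> (t + 1) s')"
proof (cases "t = horizon M - 1")
  case True
  with assms have "horizon M \<le> t + 1"
    by simp
  then have "state_value M \<pi> (t + 1) = (\<lambda>_. 0)" "pdis_variance M \<pi> \<pi> (t + 1) s' = 0" for s'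
    by (simp_all add: state_value_horizon pdis_variance_horizon fun_eq_iff)
  with True show ?thesis
    by (simp add: q_hat_def next_value_variance_def)
qed (simp add: q_hat_def)

text \<open>Conditioning on the next state splits the variance of the return into the variance of
  the next value and the mean of the remaining variances. Adding the squared mean gives the second
  moment.\<close>

lemma q_hat_eq_second_moment:
  fixes M :: "('s::finite, 'a::finite) mdp"
  assumes t: "t < horizon M"
  shows "q_hat M \<pi> t s a =
    measure_pmf.expectation (traj_sa M \<pi> t s a) (\<lambda>\<tau>. (total_reward M t \<tau>)\<^sup>2)"
proof -
  define r where "r = reward M s a"
  define p where "p = pmf (transition M s a)"
  define v where "v = state_value M \<pi> (Suc t)"
  define z where "z s' = measure_pmf.expectation (traj M \<pi> (Suc t) s') (\<lambda>\<tau>. (total_reward M (Suc t) \<tau>)\<^sup>2)" for s'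
  have p1: "sum p UNIV = 1"
    unfolding p_def by (rule sum_pmf_eq_1) auto
  have E: "measure_pmf.expectation (transition M s a) f = (\<Sum>s'\<in>UNIV. p s' * f s')" for f :: "'s \<Rightarrow> real"
    unfolding p_def by (subst integral_measure_pmf_real[of UNIV]) (auto simp: mult.commute)
  \<comment> \<open>Finite support makes every function integrable, so expectations can be split
    over sums.\<close>
  have int: "integrable (measure_pmf (traj M \<pi> (Suc t) s')) f" for f :: "('s, 'a) segment \<Rightarrow> real" and s'
    by (rule integrable_measure_pmf_finite[OF finite_set_traj])
  have "measure_pmf.expectation (traj M \<pi> (Suc t) s') (\<lambda>\<tau>. r + total_reward M (Suc t) \<tau>) = r + v s'" for s'
    by (simp add: Bochner_Integration.integral_add int v_def state_value_def)
  then have "action_value M \<pi> t s a = (\<Sum>s'\<in>UNIV. p s' * (r + v s'))"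
    by (simp add: action_value_def expectation_traj_sa total_reward_Cons[OF t] r_def p_def)
  then have q: "action_value M \<pi> t s a = r + (\<Sum>s'\<in>UNIV. p s' * v s')"
    using p1 by (simp add: distrib_left sum.distrib flip: sum_distrib_right)
  have "next_value_variance M \<pi> t s a = (\<Sum>s'\<in>UNIV. p s' * (v s')\<^sup>2) - (\<Sum>s'\<in>UNIV. p s' * v s')\<^sup>2"
    unfolding next_value_variance_def by (subst pmf_variance_eq) (simp_all add: E v_def)
  moreover have "pdis_variance M \<pi> \<pi> (t + 1) s' = z s' - (v s')\<^sup>2" for s'
    by (simp add: pdis_variance_on_policy z_def v_def)
  \<comment> \<open>The squared mean of \<open>v\<close> cancels between the first two parts of
    \<open>q_hat\<close>, and the mean of its square between the last two.\<close>
  ultimately have lhs: "q_hat M \<pi> t s a = r\<^sup>2 + 2 * r * (\<Sum>s'\<in>UNIV. p s' * v s') + (\<Sum>s'\<in>UNIV. p s' * z s')"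
    by (simp add: q_hat_eq[OF t] q power2_sum right_diff_distrib sum_subtractf flip: p_def)
  have "measure_pmf.expectation (traj M \<pi> (Suc t) s') (\<lambda>\<tau>. (r + total_reward M (Suc t) \<tau>)\<^sup>2)
      = r\<^sup>2 + z s' + 2 * r * v s'" for s'
    by (simp add: power2_sum Bochner_Integration.integral_add int v_def state_value_def z_def)
  then have "measure_pmf.expectation (traj_sa M \<pi> t s a) (\<lambda>\<tau>. (total_reward M t \<tau>)\<^sup>2)
      = (\<Sum>s'\<in>UNIV. p s' * (r\<^sup>2 + z s' + 2 * r * v s'))"
    by (simp add: expectation_traj_sa total_reward_Cons[OF t] r_def p_def)
  also have "\<dots> = (\<Sum>s'\<in>UNIV. p s') * r\<^sup>2 + (\<Sum>s'\<in>UNIV. p s' * z s') + 2 * r * (\<Sum>s'\<in>UNIV. p s' * v s')"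
    by (simp add: distrib_left sum.distrib sum_distrib_left sum_distrib_right mult_ac)
  finally show ?thesis
    by (simp add: lhs p1)
qed

lemma q_hat_nonneg:
  fixes M :: "('s::finite, 'a::finite) mdp"
  assumes "t < horizon M"
  shows "0 \<le> q_hat M \<pi> t s a"
  by (simp add: q_hat_eq_second_moment[OF assms])

text \<open>A random variable with second moment 0 has mean 0, since its variance is non-negative.
  This carries the constraint in \<open>Lambda_hat\<close> over from \<open>q_hat\<close> to the
  means.\<close>

lemma action_value_eq_0:
  fixes M :: "('s::finite, 'a::finite) mdp"
  assumes t: "t < horizon M" and "q_hat M \<pi> t s a = 0"
  shows "action_value M \<pi> t s a = 0"
proof -
  have "0 \<le> measure_pmf.variance (traj_sa M \<pi> t s a) (total_reward M t)"
    by simp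
  then show ?thesis
    using assms(2) unfolding pmf_variance_eq[OF finite_set_traj_sa]
    by (simp add: q_hat_eq_second_moment[OF t] action_value_def)
qed

section \<open>The variance as a function of the first-step distribution\<close>

lemma pdis_variance_upd:
  fixes M :: "('s::finite, 'a::finite) mdp" and \<pi> :: "('s, 'a) policy"
  assumes t: "t < horizon M"
    and m: "\<And>a. pmf (m s) a = 0 \<Longrightarrow> pmf (\<pi> t s) a * q_hat M \<pi> t s a = 0"
  shows "pdis_variance M \<pi> (\<pi>(t := m)) t s =
    (\<Sum>a\<in>UNIV. (pmf (\<pi> t s) a)\<^sup>2 * q_hat M \<pi> t s a / pmf (m s) a)
    - (\<Sum>a\<in>UNIV. pmf (\<pi> t s) a * action_value M \<pi> t s a)\<^sup>2"
proof -
  let ?\<mu> = "\<pi>(t := m)"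
  let ?\<rho> = "\<lambda>a. pmf (\<pi> t s) a / pmf (m s) a"
  have E: "measure_pmf.expectation (traj M ?\<mu> t s) f =
      (\<Sum>a\<in>UNIV. pmf (m s) a * measure_pmf.expectation (traj_sa M \<pi> t s a) f)"
    for f :: "('s, 'a) segment \<Rightarrow> real"
    unfolding traj_eq_bind_traj_sa[OF t]
    by (subst pmf_expectation_bind[of UNIV]) (auto simp: finite_set_traj_sa traj_sa_upd)
  have "measure_pmf.expectation (traj_sa M \<pi> t s a) (\<lambda>\<tau>. (pdis M \<pi> ?\<mu> t \<tau>)\<^sup>2) =
      measure_pmf.expectation (traj_sa M \<pi> t s a) (\<lambda>\<tau>. (?\<rho> a)\<^sup>2 * (total_reward M t \<tau>)\<^sup>2)" for a
    by (rule expectation_cong_pmf) (simp add: pdis_upd_traj_sa[OF t] power_mult_distrib power_divide)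
  then have "measure_pmf.expectation (traj_sa M \<pi> t s a) (\<lambda>\<tau>. (pdis M \<pi> ?\<mu> t \<tau>)\<^sup>2) =
      (?\<rho> a)\<^sup>2 * q_hat M \<pi> t s a" for a
    by (simp add: q_hat_eq_second_moment[OF t])
  \<comment> \<open>Weighting \<open>?\<rho> a\<close> squared by \<open>pmf (m s) a\<close> cancels
    one denominator. Where that probability is 0, both summands are 0.\<close>
  then have second: "measure_pmf.expectation (traj M ?\<mu> t s) (\<lambda>\<tau>. (pdis M \<pi> ?\<mu> t \<tau>)\<^sup>2) =
      (\<Sum>a\<in>UNIV. (pmf (\<pi> t s) a)\<^sup>2 * q_hat M \<pi> t s a / pmf (m s) a)"
    unfolding E by (intro sum.cong) (auto simp: power2_eq_square)
  have "measure_pmf.expectation (traj_sa M \<pi> t s a) (pdis M \<pi> ?\<mu> t) =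
      measure_pmf.expectation (traj_sa M \<pi> t s a) (\<lambda>\<tau>. ?\<rho> a * total_reward M t \<tau>)" for a
    by (rule expectation_cong_pmf) (simp add: pdis_upd_traj_sa[OF t])
  then have "measure_pmf.expectation (traj_sa M \<pi> t s a) (pdis M \<pi> ?\<mu> t) =
      ?\<rho> a * action_value M \<pi> t s a" for a
    by (simp add: action_value_def)
  \<comment> \<open>Unbiasedness uses the constraint: where \<open>m\<close> vanishes the left
    summand is 0, and so must be the right one. There either the target probability or
    \<open>q_hat\<close>, hence the action value, is 0.\<close>
  then have first: "measure_pmf.expectation (traj M ?\<mu> t s) (pdis M \<pi> ?\<mu> t) =
      (\<Sum>a\<in>UNIV. pmf (\<pi> t s) a * action_value M \<pi> t s a)"
    unfolding E using m action_value_eq_0[OF t, of \<pi> s] by (intro sum.cong) fastforce+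
  have "measure_pmf.variance (traj M ?\<mu> t s) (pdis M \<pi> ?\<mu> t) =
      measure_pmf.expectation (traj M ?\<mu> t s) (\<lambda>\<tau>. (pdis M \<pi> ?\<mu> t \<tau>)\<^sup>2)
      - (measure_pmf.expectation (traj M ?\<mu> t s) (pdis M \<pi> ?\<mu> t))\<^sup>2"
    by (rule pmf_variance_eq[OF finite_set_traj])
  then show ?thesis
    unfolding pdis_variance_def second unfolding first .
qed

section \<open>The lower bound and its equality case\<close>

lemma sum_squared_le_sum_divide_pmf:
  fixes p :: "'a::finite pmf" and w :: "'a \<Rightarrow> real"
  assumes "\<And>a. pmf p a = 0 \<Longrightarrow> w a = 0"
  shows "(\<Sum>a\<in>UNIV. w a)\<^sup>2 \<le> (\<Sum>a\<in>UNIV. (w a)\<^sup>2 / pmf p a)"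
proof -
  \<comment> \<open>This splitting makes the second Cauchy-Schwarz factor the total mass 1. Where
    \<open>p\<close> vanishes it holds because \<open>w\<close> does.\<close>
  have "(\<Sum>a\<in>UNIV. w a) = (\<Sum>a\<in>UNIV. w a / sqrt (pmf p a) * sqrt (pmf p a))"
    using assms by (intro sum.cong) auto
  then have "(\<Sum>a\<in>UNIV. w a)\<^sup>2
      \<le> (\<Sum>a\<in>UNIV. (w a / sqrt (pmf p a))\<^sup>2) * (\<Sum>a\<in>UNIV. (sqrt (pmf p a))\<^sup>2)"
    by (simp only: Cauchy_Schwarz_ineq_sum)
  also have "(\<Sum>a\<in>UNIV. (sqrt (pmf p a))\<^sup>2) = 1"
    by (simp add: sum_pmf_eq_1)
  finally show ?thesis
    by (simp add: power_divide)
qed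

lemma sum_divide_proportional_pmf:
  fixes w :: "'a::finite \<Rightarrow> real"
  assumes nonneg: "\<And>a. 0 \<le> w a"
  shows "(\<Sum>a\<in>UNIV. (w a)\<^sup>2 / pmf (proportional_pmf w) a) = (\<Sum>a\<in>UNIV. w a)\<^sup>2"
proof (cases "\<forall>b. w b = 0")
  case False
  \<comment> \<open>One factor \<open>w a\<close> cancels against the density; for
    \<open>w a = 0\<close> both sides are 0.\<close>
  have "(w a)\<^sup>2 / pmf (proportional_pmf w) a = w a * (\<Sum>b\<in>UNIV. w b)" for a
    using False by (simp add: pmf_proportional_pmf[OF nonneg] power2_eq_square)
  then show ?thesis
    by (simp add: power2_eq_square sum_distrib_right)
qed simp

text \<open>Unless \<open>w\<close> vanishes identically its sum is nonzero, so a zero of the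
  density comes from the numerator. This makes \<open>mu_hat\<close> feasible.\<close>

lemma pmf_proportional_pmf_eq_0:
  fixes w :: "'a::finite \<Rightarrow> real"
  assumes nonneg: "\<And>a. 0 \<le> w a" and "pmf (proportional_pmf w) a = 0"
  shows "w a = 0"
  using assms(2) sum_nonneg_eq_0_iff[of UNIV w] nonneg
  by (auto simp: pmf_proportional_pmf[OF nonneg] split: if_splits)

section \<open>Optimality of \<open>mu_hat\<close>\<close>

theorem theorem2:
  fixes M :: "('s::finite, 'a::finite) mdp"
    and K :: nat
    and \<pi> :: "nat \<Rightarrow> ('s, 'a) policy"
    and t :: nat
    and s :: 's
  assumes "horizon M \<ge> 1"
    and "K \<ge> 1"
    and "t \<in> {0..horizon M - 1}"
  shows "is_arg_min
    (\<lambda>m. \<Sum>k = 1..K. pdis_variance M (\<pi> k) ((\<pi> k)(t := m)) t s)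
    (\<lambda>m. m \<in> Lambda_hat M K \<pi> t)
    (mu_hat M K \<pi> t)"
proof -
  have t: "t < horizon M"
    using assms by auto
  \<comment> \<open>The state \<open>x\<close> stays free because \<open>Lambda_hat\<close>
    constrains every state, while the objective sees only \<open>s\<close>.\<close>
  define u where "u x a = (\<Sum>k = 1..K. (pmf (\<pi> k t x) a)\<^sup>2 * q_hat M (\<pi> k) t x a)" for x a
  define w where "w x a = sqrt (u x a)" for x a
  define c where "c = (\<Sum>k = 1..K. (\<Sum>a\<in>UNIV. pmf (\<pi> k t s) a * action_value M (\<pi> k) t s a)\<^sup>2)"
  have terms_nonneg: "0 \<le> (pmf (\<pi> k t x) a)\<^sup>2 * q_hat M (\<pi> k) t x a" for k x a
    by (simp add: q_hat_nonneg[OF t])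
  then have u_nonneg: "0 \<le> u x a" for x a
    unfolding u_def by (intro sum_nonneg)
  then have w_nonneg: "0 \<le> w x a" for x a
    by (simp add: w_def)
  have w_squared: "(w x a)\<^sup>2 = u x a" for x a
    by (simp add: w_def u_nonneg)
  \<comment> \<open>A sum of non-negative terms vanishes only termwise, so the constraints for all
    \<open>k\<close> merge into one on the zeros of \<open>w\<close>.\<close>
  have w_eq_0: "w x a = 0 \<longleftrightarrow> (\<forall>k\<in>{1..K}. pmf (\<pi> k t x) a * q_hat M (\<pi> k) t x a = 0)" for x a
    unfolding w_def u_def real_sqrt_eq_0_iff
    by (subst sum_nonneg_eq_0_iff) (use terms_nonneg in auto)
  have mu: "mu_hat M K \<pi> t x = proportional_pmf (w x)" for x
    by (simp add: mu_hat_def w_def [abs_def] u_def)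
  have Lambda: "m \<in> Lambda_hat M K \<pi> t \<longleftrightarrow> (\<forall>x a. pmf (m x) a = 0 \<longrightarrow> w x a = 0)" for m
    unfolding Lambda_hat_def w_eq_0 by blast
  have mu_Lambda: "mu_hat M K \<pi> t \<in> Lambda_hat M K \<pi> t"
    unfolding Lambda mu by (auto intro: pmf_proportional_pmf_eq_0 w_nonneg)
  have objective: "(\<Sum>k = 1..K. pdis_variance M (\<pi> k) ((\<pi> k)(t := m)) t s)
      = (\<Sum>a\<in>UNIV. (w s a)\<^sup>2 / pmf (m s) a) - c" if "m \<in> Lambda_hat M K \<pi> t" for m
  proof -
    have "pdis_variance M (\<pi> k) ((\<pi> k)(t := m)) t s =
        (\<Sum>a\<in>UNIV. (pmf (\<pi> k t s) a)\<^sup>2 * q_hat M (\<pi> k) t s a / pmf (m s) a)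
        - (\<Sum>a\<in>UNIV. pmf (\<pi> k t s) a * action_value M (\<pi> k) t s a)\<^sup>2" if "k \<in> {1..K}" for k
      using \<open>m \<in> _\<close> that by (intro pdis_variance_upd[OF t]) (auto simp: Lambda_hat_def)
    then have "(\<Sum>k = 1..K. pdis_variance M (\<pi> k) ((\<pi> k)(t := m)) t s) =
        (\<Sum>k = 1..K. \<Sum>a\<in>UNIV. (pmf (\<pi> k t s) a)\<^sup>2 * q_hat M (\<pi> k) t s a / pmf (m s) a) - c"
      by (simp add: sum_subtractf c_def)
    also have "(\<Sum>k = 1..K. \<Sum>a\<in>UNIV. (pmf (\<pi> k t s) a)\<^sup>2 * q_hat M (\<pi> k) t s a / pmf (m s) a)
        = (\<Sum>a\<in>UNIV. (w s a)\<^sup>2 / pmf (m s) a)"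
      by (subst sum.swap) (simp add: w_squared u_def sum_divide_distrib)
    finally show ?thesis .
  qed
  have "(\<Sum>k = 1..K. pdis_variance M (\<pi> k) ((\<pi> k)(t := mu_hat M K \<pi> t)) t s)
      \<le> (\<Sum>k = 1..K. pdis_variance M (\<pi> k) ((\<pi> k)(t := m)) t s)"
    if m: "m \<in> Lambda_hat M K \<pi> t" for m
  proof -
    have "(\<Sum>a\<in>UNIV. (w s a)\<^sup>2 / pmf (mu_hat M K \<pi> t s) a) = (\<Sum>a\<in>UNIV. w s a)\<^sup>2"
      unfolding mu by (rule sum_divide_proportional_pmf[OF w_nonneg])
    also have "\<dots> \<le> (\<Sum>a\<in>UNIV. (w s a)\<^sup>2 / pmf (m s) a)"
      using m by (intro sum_squared_le_sum_divide_pmf) (auto simp: Lambda)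
    finally show ?thesis
      unfolding objective[OF m] objective[OF mu_Lambda] by simp
  qed
  with mu_Lambda show ?thesis
    unfolding is_arg_min_def by (auto simp: not_less)
qed

end
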